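(* The mapping $\tilde{\Gamma}:\tilde{\mathbb{I}}\to\tilde{\mathbb{I}}$ given, for $\alpha=\langle\mu_\alpha,\nu_\alpha\rangle\in\tilde{\mathbb{I}}$, by $$\tilde{\Gamma}(\alpha)=\begin{cases}\langle 0,1\rangle, & L(\alpha)=0,\\ \langle 1,0\rangle, & L(\alpha)=1,\\ \alpha, & L(\alpha)=\frac12,\\ \left\langle \frac{\mu_\alpha}{2(1-L(\alpha))},\ \frac{\mu_\alpha+2-4L(\alpha)}{2(1-L(\alpha))}\right\rangle, & 0<L(\alpha)<\frac12,\\ \left\langle \frac12\left(\frac{\mu_\alpha}{1-L(\alpha)}-\frac{(2L(\alpha)-1)^2}{L(\alpha)(1-L(\alpha))}\right),\ \frac{L(\alpha)\mu_\alpha-(2L(\alpha)-1)}{2L(\alpha)(1-L(\alpha))}\right\rangle, & \frac12<L(\alpha)<1,\end{cases}$$ is an isomorphism between the posets $(\tilde{\mathbb{I}},\leq_{\mathrm{ZX}})$ and $(\tilde{\mathbb{I}},\leq_{\mathrm{XY}})$.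
   Context: $\tilde{\mathbb{I}}=\{\langle\mu,\nu\rangle\in[0,1]^2 \mid \mu+\nu\le 1\}$ is the set of intuitionistic fuzzy values. For $\alpha=\langle\mu_\alpha,\nu_\alpha\rangle\in\tilde{\mathbb{I}}$ put $s(\alpha)=\mu_\alpha-\nu_\alpha$ (score), $h(\alpha)=\mu_\alpha+\nu_\alpha$ (accuracy), and $L(\alpha)=\frac{1-\nu_\alpha}{(1-\mu_\alpha)+(1-\nu_\alpha)}$ (similarity function). Order $\mathrm{XY}$: $\alpha<_{\mathrm{XY}}\beta$ iff $s(\alpha)<s(\beta)$, or $s(\alpha)=s(\beta)$ and $h(\alpha)<h(\beta)$; $\alpha\leq_{\mathrm{XY}}\beta$ iff $\alpha<_{\mathrm{XY}}\beta$ or $\alpha=\beta$. Order $\mathrm{ZX}$: $\alpha<_{\mathrm{ZX}}\beta$ iff $L(\alpha)<L(\beta)$, or $L(\alpha)=L(\beta)$ and $h(\alpha)<h(\beta)$; $\alpha\leq_{\mathrm{ZX}}\beta$ iff $\alpha<_{\mathrm{ZX}}\beta$ or $\alpha=\beta$. An isomorphism of posets is a bijection $f$ such that both $f$ and $f^{-1}$ are order preserving. *)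

theory Defs
  imports Complex_Main
begin

text \<open>An intuitionistic fuzzy value is a pair of membership degree and nonmembership degree.\<close>

definition ifv :: "(real \<times> real) set" where
  "ifv = {(\<mu>, \<nu>). 0 \<le> \<mu> \<and> \<mu> \<le> 1 \<and> 0 \<le> \<nu> \<and> \<nu> \<le> 1 \<and> \<mu> + \<nu> \<le> 1}"

definition score :: "real \<times> real \<Rightarrow> real" where
  "score \<alpha> = fst \<alpha> - snd \<alpha>"

definition accuracy :: "real \<times> real \<Rightarrow> real" where
  "accuracy \<alpha> = fst \<alpha> + snd \<alpha>"

text \<open>On \<open>ifv\<close> the denominator is at least 1.\<close>

definition simil :: "real \<times> real \<Rightarrow> real" where
  "simil \<alpha> = (1 - snd \<alpha>) / ((1 - fst \<alpha>) + (1 - snd \<alpha>))"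

definition less_XY :: "real \<times> real \<Rightarrow> real \<times> real \<Rightarrow> bool" where
  "less_XY \<alpha> \<beta> \<longleftrightarrow>
     score \<alpha> < score \<beta> \<or> (score \<alpha> = score \<beta> \<and> accuracy \<alpha> < accuracy \<beta>)"

definition le_XY :: "real \<times> real \<Rightarrow> real \<times> real \<Rightarrow> bool" where
  "le_XY \<alpha> \<beta> \<longleftrightarrow> less_XY \<alpha> \<beta> \<or> \<alpha> = \<beta>"

definition less_ZX :: "real \<times> real \<Rightarrow> real \<times> real \<Rightarrow> bool" where
  "less_ZX \<alpha> \<beta> \<longleftrightarrow>
     simil \<alpha> < simil \<beta> \<or> (simil \<alpha> = simil \<beta> \<and> accuracy \<alpha> < accuracy \<beta>)"

definition le_ZX :: "real \<times> real \<Rightarrow> real \<times> real \<Rightarrow> bool" where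
  "le_ZX \<alpha> \<beta> \<longleftrightarrow> less_ZX \<alpha> \<beta> \<or> \<alpha> = \<beta>"

definition poset :: "'a set \<Rightarrow> ('a \<Rightarrow> 'a \<Rightarrow> bool) \<Rightarrow> bool" where
  "poset A le \<longleftrightarrow> partial_order_on A {(x, y). x \<in> A \<and> y \<in> A \<and> le x y}"

definition poset_iso ::
  "'a set \<Rightarrow> ('a \<Rightarrow> 'a \<Rightarrow> bool) \<Rightarrow> 'b set \<Rightarrow> ('b \<Rightarrow> 'b \<Rightarrow> bool) \<Rightarrow> ('a \<Rightarrow> 'b) \<Rightarrow> bool" where
  "poset_iso A leA B leB f \<longleftrightarrow>
     bij_betw f A B \<and> monotone_on A leA leB f \<and> monotone_on B leB leA (inv_into A f)"

text \<open>On \<open>ifv\<close> the similarity takes values in the unit interval, so there the final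
  branch is exactly the case of similarity strictly between 1/2 and 1.\<close>

definition Gam :: "real \<times> real \<Rightarrow> real \<times> real" where
  "Gam \<alpha> = (let \<mu> = fst \<alpha>; L = simil \<alpha> in
     if L = 0 then (0, 1)
     else if L = 1 then (1, 0)
     else if L = 1 / 2 then \<alpha>
     else if 0 < L \<and> L < 1 / 2 then
       (\<mu> / (2 * (1 - L)), (\<mu> + 2 - 4 * L) / (2 * (1 - L)))
     else
       (1 / 2 * (\<mu> / (1 - L) - (2 * L - 1)\<^sup>2 / (L * (1 - L))),
        (L * \<mu> - (2 * L - 1)) / (2 * L * (1 - L))))"

end

theory Submission imports Defs begin

text \<open>Put \<open>d = 2 L - 1\<close>. Then \<open>d (2 - h) = s\<close>, so a value is determined by \<open>L\<close> and \<open>h\<close>.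
  In each of its branches the map preserves the accuracy \<open>h\<close> and sends the score to
  \<open>2 d / (1 + \<bar>d\<bar>)\<close>, a strictly increasing function of \<open>L\<close> alone. Hence it carries the
  lexicographic order by \<open>(L, h)\<close> to the one by \<open>(s, h)\<close>. The inverse replaces the score \<open>\<sigma>\<close> by
  \<open>\<sigma> (2 - h) / (2 - \<bar>\<sigma>\<bar>)\<close> and keeps the accuracy.\<close>

text \<open>The strict part is irreflexive and transitive because it compares the pairs of keys
  lexicographically; antisymmetry then leaves only the disjunct \<open>x = y\<close>.\<close>

lemma poset_lexI:
  fixes k :: "'a \<Rightarrow> 'b :: linorder" and h :: "'a \<Rightarrow> 'c :: linorder"
  assumes "\<And>x y. le x y \<longleftrightarrow> (k x < k y \<or> (k x = k y \<and> h x < h y)) \<or> x = y"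
  shows "poset A le"
  unfolding poset_def partial_order_on_def preorder_on_def assms
  by (auto simp: refl_on_def intro!: transI antisymI)

lemma poset_isoI:
  assumes bij: "bij_betw f A B"
    and iff: "\<And>x y. x \<in> A \<Longrightarrow> y \<in> A \<Longrightarrow> leB (f x) (f y) \<longleftrightarrow> leA x y"
  shows "poset_iso A leA B leB f"
proof -
  have "leA (inv_into A f u) (inv_into A f v)" if "u \<in> B" "v \<in> B" "leB u v" for u v
  proof -
    have "inv_into A f u \<in> A" "inv_into A f v \<in> A"
      using bij that by (auto simp: bij_betw_def intro: inv_into_into)
    then show ?thesis
      using iff bij that by (metis bij_betw_inv_into_right)
  qed
  then show ?thesis
    using bij iff by (auto simp: poset_iso_def monotone_on_def)
qed

text \<open>The coordinates are half of accuracy plus or minus score, so both are nonnegative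
  exactly when accuracy dominates the absolute score.\<close>

lemma ifv_iff_score_accuracy: "\<alpha> \<in> ifv \<longleftrightarrow> \<bar>score \<alpha>\<bar> \<le> accuracy \<alpha> \<and> accuracy \<alpha> \<le> 1"
  by (cases \<alpha>) (auto simp: ifv_def score_def accuracy_def)

lemma eq_if_score_accuracy_eq:
  assumes "score \<alpha> = score \<beta>" "accuracy \<alpha> = accuracy \<beta>"
  shows "\<alpha> = \<beta>"
  using assms by (auto simp: score_def accuracy_def prod_eq_iff)

text \<open>The denominator of \<open>simil\<close> is 2 minus the accuracy, which is nonzero on
  \<open>ifv\<close>.\<close>

lemma simil_score:
  assumes "\<alpha> \<in> ifv"
  shows "(2 * simil \<alpha> - 1) * (2 - accuracy \<alpha>) = score \<alpha>"
  using assms by (cases \<alpha>) (auto simp: ifv_def simil_def score_def accuracy_def field_simps)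

lemma simil_bounds:
  assumes "\<alpha> \<in> ifv"
  shows "0 \<le> simil \<alpha>" "simil \<alpha> \<le> 1"
  using assms by (cases \<alpha>; auto simp: ifv_def simil_def divide_simps)+

text \<open>\<open>simil_score\<close> rearranged to express \<nu> through L and \<mu>. The factor 1
  - L stays undivided so that L = 1 is covered, where it forces \<mu> = 1.\<close>

lemma snd_eq_simil:
  assumes "\<alpha> \<in> ifv"
  shows "(1 - simil \<alpha>) * snd \<alpha> = simil \<alpha> * fst \<alpha> + 1 - 2 * simil \<alpha>"
  using simil_score[OF assms] by (simp add: score_def accuracy_def algebra_simps)

lemma simil_eq_0D:
  assumes "\<alpha> \<in> ifv" "simil \<alpha> = 0"
  shows "\<alpha> = (0, 1)"
  using assms snd_eq_simil[OF assms(1)] by (cases \<alpha>) (auto simp: ifv_def)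

lemma simil_eq_1D:
  assumes "\<alpha> \<in> ifv" "simil \<alpha> = 1"
  shows "\<alpha> = (1, 0)"
  using assms snd_eq_simil[OF assms(1)] by (cases \<alpha>) (auto simp: ifv_def)

lemma Gam_accuracy:
  assumes "\<alpha> \<in> ifv"
  shows "accuracy (Gam \<alpha>) = accuracy \<alpha>"
proof -
  obtain \<mu> \<nu> where \<alpha>: "\<alpha> = (\<mu>, \<nu>)" by (cases \<alpha>)
  define L where "L = simil \<alpha>"
  note Gam = Gam_def[of \<alpha>, folded L_def, unfolded Let_def \<alpha> fst_conv]
  consider "L = 0" | "L = 1" | "L = 1 / 2" | "0 < L" "L < 1 / 2" | "1 / 2 < L" "L < 1"
    using simil_bounds[OF assms] by (fastforce simp: L_def)
  then show ?thesis
  proof cases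
    case 1
    then show ?thesis
      using simil_eq_0D[OF assms] by (auto simp: L_def Gam_def)
  next
    case 2
    then show ?thesis
      using simil_eq_1D[OF assms] by (auto simp: L_def Gam_def)
  next
    case 3
    then show ?thesis
      by (auto simp: L_def Gam_def)
  next
    case 4
    \<comment> \<open>Eliminating \<nu> turns the claim into a rational identity in L and
      \<mu>.\<close>
    have \<nu>: "\<nu> = (L * \<mu> + 1 - 2 * L) / (1 - L)"
      using snd_eq_simil[OF assms] 4 by (simp add: L_def \<alpha> field_simps)
    have "Gam \<alpha> = (\<mu> / (2 * (1 - L)), (\<mu> + 2 - 4 * L) / (2 * (1 - L)))"
      using 4 by (simp add: Gam \<alpha>)
    then show ?thesis
      using 4 unfolding \<alpha> accuracy_def \<nu> by (simp add: divide_simps) (simp add: algebra_simps)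
  next
    case 5
    have \<nu>: "\<nu> = (L * \<mu> + 1 - 2 * L) / (1 - L)"
      using snd_eq_simil[OF assms] 5 by (simp add: L_def \<alpha> field_simps)
    have "Gam \<alpha> = (1 / 2 * (\<mu> / (1 - L) - (2 * L - 1)\<^sup>2 / (L * (1 - L))),
        (L * \<mu> - (2 * L - 1)) / (2 * L * (1 - L)))"
      using 5 by (simp add: Gam \<alpha>)
    then show ?thesis
      using 5 unfolding \<alpha> accuracy_def \<nu>
      by (simp add: divide_simps) (simp add: algebra_simps power2_eq_square)
  qed
qed

text \<open>The absolute value merges the branches of \<open>Gam\<close>: for d = 2 L - 1 the
  denominator is 2 (1 - L) when L \<le> 1/2 and 2 L when L \<ge> 1/2.\<close>

definition rescale :: "real \<Rightarrow> real" where
  "rescale d = 2 * d / (1 + \<bar>d\<bar>)"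

lemma strict_mono_rescale: "strict_mono rescale"
proof (rule strict_monoI)
  fix x y :: real
  assume "x < y"
  \<comment> \<open>What remains after cross-multiplying: equality for equal signs, and a
    nonpositive against a nonnegative number for x < 0 \<le> y.\<close>
  moreover have "x * \<bar>y\<bar> \<le> y * \<bar>x\<bar>" if "x < y"
    using that by (cases "0 \<le> x"; cases "0 \<le> y")
      (auto simp: mult_nonpos_nonneg mult_nonneg_nonneg)
  ultimately have "x * (1 + \<bar>y\<bar>) < y * (1 + \<bar>x\<bar>)"
    by (simp add: algebra_simps)
  moreover have "0 < 1 + \<bar>x\<bar>" "0 < 1 + \<bar>y\<bar>" by simp_all
  ultimately show "rescale x < rescale y"
    by (simp only: rescale_def divide_less_eq less_divide_eq times_divide_eq_left if_True mult.assoc)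
qed

text \<open>Both inequalities rearrange to 2 \<bar>d\<bar> \<le> h (1 + \<bar>d\<bar>). For d = 2 L
  - 1 the assumption bounds the score of the argument of \<open>Gam\<close>, the conclusion that of
  its image.\<close>

lemma rescale_bound:
  assumes "\<bar>d\<bar> * (2 - h) \<le> h"
  shows "\<bar>rescale d\<bar> \<le> h"
proof -
  have "0 < 1 + \<bar>d\<bar>" by simp
  then show ?thesis
    using assms by (simp add: rescale_def abs_mult pos_divide_le_eq) (simp add: algebra_simps)
qed

lemma rescale_inverse:
  assumes "\<bar>\<sigma>\<bar> \<le> 1"
  shows "rescale (\<sigma> / (2 - \<bar>\<sigma>\<bar>)) = \<sigma>"
  using assms by (auto simp: rescale_def abs_if divide_simps split: if_splits)

text \<open>In both fractional branches \<mu> cancels from the difference of the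
  coordinates.\<close>

lemma Gam_score:
  assumes "\<alpha> \<in> ifv"
  shows "score (Gam \<alpha>) = rescale (2 * simil \<alpha> - 1)"
proof -
  obtain \<mu> \<nu> where \<alpha>: "\<alpha> = (\<mu>, \<nu>)" by (cases \<alpha>)
  define L where "L = simil \<alpha>"
  note Gam = Gam_def[of \<alpha>, folded L_def, unfolded Let_def \<alpha> fst_conv]
  consider "L = 0" | "L = 1" | "L = 1 / 2" | "0 < L" "L < 1 / 2" | "1 / 2 < L" "L < 1"
    using simil_bounds[OF assms] by (fastforce simp: L_def)
  then have "score (Gam \<alpha>) = rescale (2 * L - 1)"
  proof cases
    case 1
    then show ?thesis
      by (simp add: L_def Gam_def score_def rescale_def)
  next
    case 2
    then show ?thesis
      by (simp add: L_def Gam_def score_def rescale_def)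
  next
    case 3
    then have "Gam \<alpha> = \<alpha>"
      by (simp add: L_def Gam_def)
    moreover have "score \<alpha> = 0"
      using simil_score[OF assms, folded L_def] 3 by simp
    ultimately show ?thesis
      using 3 by (simp add: rescale_def)
  next
    case 4
    have "Gam \<alpha> = (\<mu> / (2 * (1 - L)), (\<mu> + 2 - 4 * L) / (2 * (1 - L)))"
      using 4 by (simp add: Gam \<alpha>)
    then show ?thesis
      using 4 by (simp add: score_def rescale_def divide_simps)
  next
    case 5
    have "Gam \<alpha> = (1 / 2 * (\<mu> / (1 - L) - (2 * L - 1)\<^sup>2 / (L * (1 - L))),
        (L * \<mu> - (2 * L - 1)) / (2 * L * (1 - L)))"
      using 5 by (simp add: Gam \<alpha>)
    then show ?thesis
      using 5 by (simp add: score_def rescale_def divide_simps)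
        (simp add: algebra_simps power2_eq_square)
  qed
  then show ?thesis by (simp add: L_def)
qed

lemma Gam_in_ifv:
  assumes "\<alpha> \<in> ifv"
  shows "Gam \<alpha> \<in> ifv"
proof -
  have h: "\<bar>score \<alpha>\<bar> \<le> accuracy \<alpha>" "accuracy \<alpha> \<le> 1"
    using assms by (auto simp: ifv_iff_score_accuracy)
  have "\<bar>2 * simil \<alpha> - 1\<bar> * (2 - accuracy \<alpha>) = \<bar>score \<alpha>\<bar>"
    using h by (simp add: simil_score[OF assms, symmetric] abs_mult)
  then show ?thesis
    using h rescale_bound by (simp add: ifv_iff_score_accuracy Gam_score Gam_accuracy assms)
qed

lemma Gam_surj:
  assumes "\<beta> \<in> ifv"
  obtains \<alpha> where "\<alpha> \<in> ifv" "Gam \<alpha> = \<beta>"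
proof -
  define \<sigma> h where "\<sigma> = score \<beta>" and "h = accuracy \<beta>"
  \<comment> \<open>The preimage of \<sigma> under \<open>rescale\<close>. The witness \<alpha> is
    the pair with accuracy h whose score s makes 2 L - 1 equal to d.\<close>
  define d where "d = \<sigma> / (2 - \<bar>\<sigma>\<bar>)"
  define s where "s = d * (2 - h)"
  define \<alpha> where "\<alpha> = ((h + s) / 2, (h - s) / 2)"
  have h: "\<bar>\<sigma>\<bar> \<le> h" "h \<le> 1"
    using assms by (auto simp: ifv_iff_score_accuracy \<sigma>_def h_def)
  have \<alpha>: "score \<alpha> = s" "accuracy \<alpha> = h"
    by (auto simp: \<alpha>_def score_def accuracy_def field_simps)
  have "\<bar>s\<bar> = \<bar>\<sigma>\<bar> * (2 - h) / (2 - \<bar>\<sigma>\<bar>)"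
    using h by (simp add: s_def d_def abs_mult)
  \<comment> \<open>After clearing the positive denominator, h \<bar>\<sigma>\<bar> cancels and
    \<bar>\<sigma>\<bar> \<le> h is left.\<close>
  also have "\<dots> \<le> h"
    using h by (simp add: divide_simps) (simp add: algebra_simps)
  finally have mem: "\<alpha> \<in> ifv"
    using h by (simp add: ifv_iff_score_accuracy \<alpha>)
  have "2 * simil \<alpha> - 1 = d"
    using simil_score[OF mem] h by (simp add: \<alpha> s_def)
  then have "score (Gam \<alpha>) = \<sigma>"
    using h by (simp add: Gam_score[OF mem] d_def rescale_inverse)
  then have "Gam \<alpha> = \<beta>"
    by (intro eq_if_score_accuracy_eq) (simp_all add: Gam_accuracy[OF mem] \<alpha> \<sigma>_def h_def)
  with mem show ?thesis by (rule that)
qed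

lemma Gam_inj: "inj_on Gam ifv"
proof (rule inj_onI)
  fix \<alpha> \<beta> assume *: "\<alpha> \<in> ifv" "\<beta> \<in> ifv" "Gam \<alpha> = Gam \<beta>"
  then have h: "accuracy \<alpha> = accuracy \<beta>"
    by (metis Gam_accuracy)
  have "simil \<alpha> = simil \<beta>"
    using Gam_score[OF *(1)] Gam_score[OF *(2)] *(3)
    by (simp add: strict_mono_eq[OF strict_mono_rescale])
  \<comment> \<open>By \<open>simil_score\<close>, similarity and accuracy together determine the
    score.\<close>
  then have "score \<alpha> = score \<beta>"
    using h simil_score * by metis
  then show "\<alpha> = \<beta>" using h by (rule eq_if_score_accuracy_eq)
qed

lemma Gam_less_iff:
  assumes "\<alpha> \<in> ifv" "\<beta> \<in> ifv"
  shows "less_XY (Gam \<alpha>) (Gam \<beta>) \<longleftrightarrow> less_ZX \<alpha> \<beta>"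
  by (simp add: less_XY_def less_ZX_def Gam_score Gam_accuracy assms
      strict_mono_less[OF strict_mono_rescale] strict_mono_eq[OF strict_mono_rescale])

theorem theorem3p1:
  shows "poset ifv le_ZX \<and> poset ifv le_XY \<and> poset_iso ifv le_ZX ifv le_XY Gam"
proof (intro conjI)
  show "poset ifv le_ZX"
    by (rule poset_lexI[of _ simil accuracy]) (simp add: le_ZX_def less_ZX_def)
  show "poset ifv le_XY"
    by (rule poset_lexI[of _ score accuracy]) (simp add: le_XY_def less_XY_def)
  have "Gam ` ifv = ifv"
  proof
    show "ifv \<subseteq> Gam ` ifv" by (metis Gam_surj image_eqI subsetI)
  qed (auto intro: Gam_in_ifv)
  \<comment> \<open>The strict disjuncts match by \<open>Gam_less_iff\<close>, the equality
    disjuncts by injectivity.\<close>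
  then show "poset_iso ifv le_ZX ifv le_XY Gam"
    by (intro poset_isoI)
      (auto simp: bij_betw_def Gam_inj le_XY_def le_ZX_def Gam_less_iff inj_on_eq_iff[OF Gam_inj])
qed

end
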